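(* Let $K\ge2$, let $\mathbf{X}\in\mathbb{R}^{n\times p}$ be a design matrix with no row equal to the zero vector, let $y_1,\dots,y_n\in\{1,\dots,K\}$, and let $\mu_j\in\mathbb{R}^p$ for $j=1,\dots,K-1$. For any $\alpha\in(0,1]$ and any positive definite $\Sigma_j\in\mathbb{R}^{p\times p}$ ($j=1,\dots,K-1$), any fixed point solution $\chi_j^*$ of the EM sequence $$(\chi_j^{t+1})^2=\mathrm{diag}\big[\mathbf{X}\{\Sigma_\alpha(\chi_j^t)/\alpha+\mu_\alpha(\chi_j^t)\mu_\alpha^\top(\chi_j^t)\}\mathbf{X}^\top\big],\qquad j\in\{1,\dots,K-1\},$$ is locally asymptotically stable.
   Context: This is the EM (tangent transform) recursion for multinomial logit regression with $K$ unordered categories and priors $\beta_j\sim\mathrm{N}_p(\mu_j,\Sigma_j)$, $j=1,\dots,K-1$. Let $Y_j=(\mathbb{1}(y_1=j),\dots,\mathbb{1}(y_n=j))^\top$ and let $\mathbf{1}_n$ be the all-ones vector. $A(t)=-\tanh(t/2)/(4t)$ with $A(0)=-1/8$, applied elementwise. For $\chi_j=(\chi_{1j},\dots,\chi_{nj})^\top$, $$\Sigma_\alpha^{-1}(\chi_j)=\Sigma_j^{-1}/\alpha-2\mathbf{X}^\top\mathrm{diag}\{A(\chi_j)\}\mathbf{X},\qquad \mu_\alpha^\top(\chi_j)\Sigma_\alpha^{-1}(\chi_j)=(Y_j-\tfrac12\mathbf{1}_n)^\top\mathbf{X}+\mu_j^\top\Sigma_j^{-1}/\alpha .$$ In the recursion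 the square is elementwise and $\mathrm{diag}[M]$ is the vector of diagonal entries of $M$. Since $A$ is even, only $|\chi_{ij}|$ matters, and $\chi_j$ is taken with nonnegative coordinates. For each $j$ the recursion is regarded as a discrete-time autonomous dynamical system $\psi^{t+1}=f(\psi^t)$ in the variable $\psi=\chi_j^2$ (elementwise square). A fixed point $\psi^*=f(\psi^* )$ is locally asymptotically stable if for any $\epsilon>0$ there is $\delta=\delta(\epsilon)>0$ such that whenever $\|\psi^0-\psi^*\|<\delta$ we have $\|f(\psi^t)-\psi^*\|<\epsilon$ for all $t$ and $\lim_{t\to\infty}\|\psi^t-\psi^*\|=0$. *)

theory Defs
  imports "HOL-Analysis.Analysis"
begin

definition pos_def_matrix :: "real^'p^'p \<Rightarrow> bool" where
  "pos_def_matrix S \<longleftrightarrow> transpose S = S \<and> (\<forall>v. v \<noteq> 0 \<longrightarrow> v \<bullet> (S *v v) > 0)"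

definition diag_matrix :: "real^'n \<Rightarrow> real^'n^'n" where
  "diag_matrix v = (\<chi> i k. if i = k then v $ i else 0)"

definition diag_entries :: "real^'n^'n \<Rightarrow> real^'n" where
  "diag_entries M = (\<chi> i. M $ i $ i)"

definition outer :: "real^'p \<Rightarrow> real^'p^'p" where
  "outer v = (columnvector v :: real^1^'p) ** (rowvector v :: real^'p^1)"

definition A_fun :: "real \<Rightarrow> real" where
  "A_fun t = (if t = 0 then - 1 / 8 else - tanh (t / 2) / (4 * t))"

definition category_indicator :: "('n \<Rightarrow> nat) \<Rightarrow> nat \<Rightarrow> real^'n" where
  "category_indicator y j = (\<chi> i. if y i = j then 1 else 0)"

text \<open>
  In the following, \<open>X\<close> has row index type \<open>'n\<close> and column index type \<open>'p\<close> (so \<open>n\<close> and \<open>p\<close> are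
  the cardinalities of these types), \<open>S\<close> and \<open>m\<close> are the prior covariance and mean of one fixed
  category \<open>j\<close>, and \<open>Y\<close> is the indicator vector of that category.
\<close>

definition precision_post :: "real^'p^'n \<Rightarrow> real \<Rightarrow> real^'p^'p \<Rightarrow> real^'n \<Rightarrow> real^'p^'p" where
  "precision_post X \<alpha> S c =
     matrix_inv S /\<^sub>R \<alpha> - 2 *\<^sub>R (transpose X ** diag_matrix (\<chi> i. A_fun (c $ i)) ** X)"

definition Sigma_post :: "real^'p^'n \<Rightarrow> real \<Rightarrow> real^'p^'p \<Rightarrow> real^'n \<Rightarrow> real^'p^'p" where
  "Sigma_post X \<alpha> S c = matrix_inv (precision_post X \<alpha> S c)"

text \<open>
  The posterior mean is the solution of the row-vector equation
  \<open>mu v* precision_post X \<alpha> S c = (Y - 1/2) v* X + (m v* matrix_inv S) / \<alpha>\<close>.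
\<close>
definition mu_post ::
  "real^'p^'n \<Rightarrow> real^'n \<Rightarrow> real \<Rightarrow> real^'p \<Rightarrow> real^'p^'p \<Rightarrow> real^'n \<Rightarrow> real^'p" where
  "mu_post X Y \<alpha> m S c =
     ((Y - (\<chi> i. 1 / 2)) v* X + (m v* matrix_inv S) /\<^sub>R \<alpha>) v* Sigma_post X \<alpha> S c"

definition em_rhs ::
  "real^'p^'n \<Rightarrow> real^'n \<Rightarrow> real \<Rightarrow> real^'p \<Rightarrow> real^'p^'p \<Rightarrow> real^'n \<Rightarrow> real^'n" where
  "em_rhs X Y \<alpha> m S c =
     diag_entries (X ** (Sigma_post X \<alpha> S c /\<^sub>R \<alpha> + outer (mu_post X Y \<alpha> m S c)) ** transpose X)"

text \<open>
  The recursion as an autonomous system in \<open>\<psi> = \<chi>\<^sup>2\<close>. Its state space is the nonnegative orthant,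
  on which the componentwise \<open>sqrt\<close> recovers \<open>\<chi>\<close> with nonnegative coordinates; outside it,
  Isabelle's \<open>sqrt\<close> takes negative values that carry no meaning here.
\<close>
definition em_map ::
  "real^'p^'n \<Rightarrow> real^'n \<Rightarrow> real \<Rightarrow> real^'p \<Rightarrow> real^'p^'p \<Rightarrow> real^'n \<Rightarrow> real^'n" where
  "em_map X Y \<alpha> m S \<psi> = em_rhs X Y \<alpha> m S (\<chi> i. sqrt (\<psi> $ i))"

definition nonneg_orthant :: "(real^'n) set" where
  "nonneg_orthant = {v. \<forall>i. 0 \<le> v $ i}"

definition locally_asymptotically_stable_on ::
  "'a::real_normed_vector set \<Rightarrow> ('a \<Rightarrow> 'a) \<Rightarrow> 'a \<Rightarrow> bool" where
  "locally_asymptotically_stable_on D f z \<longleftrightarrow>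
     z \<in> D \<and> f z = z \<and>
     (\<forall>\<epsilon>>0. \<exists>\<delta>>0. \<forall>x0\<in>D. norm (x0 - z) < \<delta> \<longrightarrow>
        (\<forall>t. norm (f ((f ^^ t) x0) - z) < \<epsilon>) \<and>
        (\<lambda>t. norm ((f ^^ t) x0 - z)) \<longlonglongrightarrow> 0)"

end

theory Submission
  imports Defs
begin

text \<open>
  Write \<open>w(s) = - 2 A(sqrt s)\<close>, \<open>Q\<close> for the posterior covariance at the fixed point \<open>\<psi>\<close>,
  \<open>H = X Q X\<^sup>T\<close> and \<open>m = X \<mu>\<close>. The derivative of the recursion there is \<open>G diag(- w'(\<psi>))\<close> with
  \<open>G i k = (H i k)\<^sup>2 / \<alpha> + 2 (H i k) (m i) (m k)\<close>. Since the posterior precision dominates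
  \<open>X\<^sup>T diag(w(\<psi>)) X\<close>, the matrix \<open>H\<close> is dominated by \<open>diag(1 / w(\<psi>))\<close>; together with the fixed point
  equation \<open>\<psi> i = H i i / \<alpha> + (m i)\<^sup>2\<close> this bounds \<open>G\<close> by \<open>diag(2 \<psi> / w(\<psi>))\<close>. As \<open>\<psi> > 0\<close> and
  \<open>|w'(s)| < w(s) / (2 s)\<close> for \<open>s > 0\<close>, the derivative is a strict contraction in the Euclidean norm
  with weights \<open>w(\<psi>) / (2 \<psi>)\<close>.
\<close>

section \<open>Stability from a contracting derivative\<close>

text \<open>Near \<open>z\<close> the map is its linear part plus an error that is small relative to
  \<open>norm (x - z)\<close>, so in the norm \<open>norm (T u)\<close> it contracts, on a small
  enough ball, at any rate above \<open>r\<close>. The map \<open>T\<close> encodes the choice of an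
  equivalent norm in which the derivative contracts.\<close>

lemma locally_asymptotically_stable_on_if_contracting_derivative:
  fixes f :: "'a::euclidean_space \<Rightarrow> 'a" and T :: "'a \<Rightarrow> 'b::euclidean_space"
  assumes z: "z \<in> D" "f z = z" and J: "(f has_derivative J) (at z)"
    and T: "linear T" "inj T" and r: "0 \<le> r" "r < 1"
    and contr: "\<And>u. norm (T (J u)) \<le> r * norm (T u)"
  shows "locally_asymptotically_stable_on D f z"
proof -
  obtain B where B: "B > 0" "\<And>x. B * norm x \<le> norm (T x)"
    using linear_inj_bounded_below_pos[OF T] by blast
  obtain C where C: "C > 0" "\<And>x. norm (T x) \<le> C * norm x"
    using linear_bounded_pos[OF T(1)] by blast
  define s where "s = (1 + r) / 2"
  have s: "0 < s" "s < 1" "r < s" using r by (auto simp: s_def)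
  \<comment> \<open>The tolerance is chosen so that the error, measured after applying
    \<open>T\<close>, uses up at most the gap \<open>s - r\<close> between the two rates.\<close>
  have "(s - r) * B / C > 0" using s B C by simp
  then obtain d where d: "d > 0"
    "\<And>x. norm (x - z) < d \<Longrightarrow> norm (f x - f z - J (x - z)) \<le> (s - r) * B / C * norm (x - z)"
    using J unfolding has_derivative_at_alt by meson
  have step: "norm (T (f x - z)) \<le> s * norm (T (x - z))" if "norm (x - z) < d" for x
  proof -
    have "T (f x - z) = T (J (x - z)) + T (f x - f z - J (x - z))"
      by (simp add: linear_diff[OF T(1)] z)
    then have "norm (T (f x - z)) \<le> norm (T (J (x - z))) + norm (T (f x - f z - J (x - z)))"
      by (metis norm_triangle_ineq)
    also have "\<dots> \<le> r * norm (T (x - z)) + C * ((s - r) * B / C * norm (x - z))"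
      using contr C(2)[of "f x - f z - J (x - z)"] d(2)[OF that] C(1)
      by (meson add_mono mult_left_mono order.trans less_imp_le)
    also have "C * ((s - r) * B / C * norm (x - z)) = (s - r) * (B * norm (x - z))"
      using C(1) by simp
    also have "\<dots> \<le> (s - r) * norm (T (x - z))"
      using B(2)[of "x - z"] s by (intro mult_left_mono) auto
    finally show ?thesis by (simp add: algebra_simps)
  qed
  \<comment> \<open>By the factor \<open>B / C\<close>, every point whose \<open>T\<close>-distance
    to \<open>z\<close> is at most that of \<open>x\<close> lies in the \<open>e\<close>-ball. The
    orbit stays among such points, so \<open>step\<close> applies again each time because
    \<open>e \<le> d\<close>.\<close>
  have orbit: "norm (T ((f ^^ t) x - z)) \<le> s ^ t * norm (T (x - z)) \<and> norm ((f ^^ t) x - z) < e"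
    if e: "0 < e" "e \<le> d" and x: "norm (x - z) < e * B / C" for e x t
  proof -
    have small: "norm (v - z) < e" if "norm (T (v - z)) \<le> norm (T (x - z))" for v
    proof -
      have "B * norm (v - z) \<le> C * norm (x - z)"
        using B(2)[of "v - z"] C(2)[of "x - z"] that by linarith
      also have "\<dots> < B * e" using x C(1) by (simp add: field_simps)
      finally show ?thesis using B(1) by simp
    qed
    show ?thesis
    proof (induction t)
      case 0
      show ?case using small by simp
    next
      case (Suc t)
      let ?v = "(f ^^ t) x"
      have "norm (T (f ?v - z)) \<le> s * norm (T (?v - z))"
        using Suc e by (intro step) auto
      also have "\<dots> \<le> s * (s ^ t * norm (T (x - z)))"
        using Suc s by (intro mult_left_mono) auto
      finally have *: "norm (T (f ?v - z)) \<le> s ^ Suc t * norm (T (x - z))" by simp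
      also have "\<dots> \<le> 1 * norm (T (x - z))"
        using s by (intro mult_right_mono power_le_one) auto
      finally show ?case using * small by simp
    qed
  qed
  show ?thesis
    unfolding locally_asymptotically_stable_on_def
  proof (intro conjI allI impI)
    fix e :: real assume "0 < e"
    define \<eta> where "\<eta> = min e d"
    have \<eta>: "0 < \<eta>" "\<eta> \<le> d" "\<eta> \<le> e" using \<open>0 < e\<close> d by (auto simp: \<eta>_def)
    have "(\<forall>t. norm (f ((f ^^ t) x) - z) < e) \<and> (\<lambda>t. norm ((f ^^ t) x - z)) \<longlonglongrightarrow> 0"
      if "norm (x - z) < \<eta> * B / C" for x
    proof
      \<comment> \<open>Stability is stated for the image of each iterate, that is, for iterate
        \<open>t + 1\<close>.\<close>
      show "\<forall>t. norm (f ((f ^^ t) x) - z) < e"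
        using orbit[OF \<eta>(1,2) that, of "Suc _"] \<eta>(3) by (auto intro: less_le_trans)
      have "(\<lambda>t. s ^ t * norm (T (x - z)) / B) \<longlonglongrightarrow> 0"
        using s B by (auto intro!: tendsto_eq_intros LIMSEQ_power_zero)
      moreover have "norm ((f ^^ t) x - z) \<le> s ^ t * norm (T (x - z)) / B" for t
        using orbit[OF \<eta>(1,2) that, of t] B(2)[of "(f ^^ t) x - z"] B(1)
        by (simp add: field_simps)
      ultimately show "(\<lambda>t. norm ((f ^^ t) x - z)) \<longlonglongrightarrow> 0"
        by (intro tendsto_sandwich[of "\<lambda>_. 0" "\<lambda>t. norm ((f ^^ t) x - z)"]) auto
    qed
    then show "\<exists>\<delta>>0. \<forall>x0\<in>D. norm (x0 - z) < \<delta> \<longrightarrow>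
        (\<forall>t. norm (f ((f ^^ t) x0) - z) < e) \<and> (\<lambda>t. norm ((f ^^ t) x0 - z)) \<longlonglongrightarrow> 0"
      using \<eta>(1) B C by (intro exI[of _ "\<eta> * B / C"]) auto
  qed (use z in auto)
qed

section \<open>Differentiability and continuity of matrix expressions\<close>

text \<open>Caratheodory's criterion in several variables: the remainder of the linear approximation
  is exactly \<open>(J x - J z) *v (x - z)\<close>, and the operator norm of
  \<open>J x - J z\<close> tends to 0. It yields the derivative of the recursion from an exact
  difference formula, without differentiating a matrix inverse.\<close>

lemma has_derivative_at_if_continuous_secant:
  fixes f :: "real^'n \<Rightarrow> real^'m" and J :: "real^'n \<Rightarrow> real^'n^'m"
  assumes secant: "\<And>x. f x - f z = J x *v (x - z)" and J: "isCont J z"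
  shows "(f has_derivative (*v) (J z)) (at z)"
proof -
  have "(\<lambda>x. onorm ((*v) (J x - J z))) \<midarrow>z\<rightarrow> 0"
  proof (rule tendsto_sandwich[of "\<lambda>_. 0"])
    show "\<forall>\<^sub>F x in at z. onorm ((*v) (J x - J z)) \<le> (\<Sum>i\<in>UNIV. \<Sum>j\<in>UNIV. \<bar>J x $ i $ j - J z $ i $ j\<bar>)"
      using onorm_le_matrix_component_sum[of "J _ - J z"] by simp
    have "((\<lambda>x. \<Sum>i\<in>UNIV. \<Sum>j\<in>UNIV. \<bar>J x $ i $ j - J z $ i $ j\<bar>) \<longlongrightarrow>
        (\<Sum>i\<in>UNIV. \<Sum>j\<in>UNIV. \<bar>J z $ i $ j - J z $ i $ j\<bar>)) (at z)"
      using J unfolding isCont_def by (intro tendsto_intros)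
    then show "((\<lambda>x. \<Sum>i\<in>UNIV. \<Sum>j\<in>UNIV. \<bar>J x $ i $ j - J z $ i $ j\<bar>) \<longlongrightarrow> 0) (at z)" by simp
  qed (auto simp: onorm_pos_le)
  then have "((\<lambda>x. norm (f x - f z - J z *v (x - z)) / norm (x - z)) \<longlongrightarrow> 0) (at z)"
  proof (rule tendsto_sandwich[OF _ _ tendsto_const, rotated 2])
    show "\<forall>\<^sub>F x in at z. norm (f x - f z - J z *v (x - z)) / norm (x - z) \<le> onorm ((*v) (J x - J z))"
    proof (intro eventually_at_topological[THEN iffD2] exI[of _ UNIV] conjI ballI impI)
      fix x assume "x \<noteq> z"
      have "norm (f x - f z - J z *v (x - z)) \<le> onorm ((*v) (J x - J z)) * norm (x - z)"
        unfolding secant matrix_vector_mult_diff_rdistrib[symmetric]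
        by (intro onorm) auto
      then show "norm (f x - f z - J z *v (x - z)) / norm (x - z) \<le> onorm ((*v) (J x - J z))"
        using \<open>x \<noteq> z\<close> by (simp add: divide_simps)
    qed auto
  qed auto
  then show ?thesis
    by (simp add: has_derivative_at2 has_derivative_iff_norm)
qed

lemma matrix_inv_inverse:
  fixes A :: "'a::field^'n^'n"
  assumes "invertible A"
  shows "A ** matrix_inv A = mat 1" "matrix_inv A ** A = mat 1"
  using someI_ex[OF assms[unfolded invertible_def]] by (auto simp: matrix_inv_def)

text \<open>By Cramer's rule each entry of the inverse is a quotient of two determinants, hence of
  polynomials in the entries of \<open>A x\<close>, with nonvanishing denominator.\<close>

lemma isCont_matrix_inv:
  fixes A :: "'a::t2_space \<Rightarrow> real^'n^'n"
  assumes A: "isCont A z" and inv: "\<And>x. invertible (A x)"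
  shows "isCont (\<lambda>x. matrix_inv (A x)) z"
proof -
  have eq: "matrix_inv (A x) $ i $ k =
      det (\<chi> a b. if b = i then axis k 1 $ a else A x $ a $ b) / det (A x)" for x i k
  proof -
    have "A x *v (matrix_inv (A x) *v axis k 1) = axis k 1"
      using inv[of x] by (simp add: matrix_vector_mul_assoc matrix_inv_inverse)
    then have "matrix_inv (A x) *v axis k 1 =
        (\<chi> i. det (\<chi> a b. if b = i then axis k 1 $ a else A x $ a $ b) / det (A x))"
      using cramer[of "A x"] inv[of x] by (simp add: invertible_det_nz)
    then show ?thesis
      by (simp add: matrix_vector_mult_basis column_def vec_eq_iff)
  qed
  have det: "isCont (\<lambda>x. det (M x)) z" if "isCont M z" for M :: "'a \<Rightarrow> real^'n^'n"
    unfolding det_def using that by (intro continuous_intros)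
  have "isCont (\<lambda>x. \<chi> a b. if b = i then axis k 1 $ a else A x $ a $ b) z" for i k
  proof -
    have "isCont (\<lambda>x. if b = i then axis k 1 $ a else A x $ a $ b) z" for a b
      using A by (cases "b = i") (auto intro!: continuous_intros)
    then show ?thesis
      unfolding isCont_def by (intro vec_tendstoI) simp
  qed
  then have "isCont (\<lambda>x. matrix_inv (A x) $ i $ k) z" for i k
    unfolding eq using inv[of z] A
    by (intro continuous_at_within_divide det) (auto simp: invertible_det_nz)
  then show ?thesis
    by (simp add: isCont_def vec_tendstoI)
qed

section \<open>The weight and its derivative\<close>

text \<open>By the mean value theorem \<open>tanh x\<close> is \<open>x\<close> times the slope
  \<open>1 - (tanh t)\<^sup>2\<close> at some \<open>t\<close> between 0 and \<open>x\<close>, and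
  this slope decreases on the positive half-line.\<close>

lemma tanh_ge_mult_deriv:
  fixes x :: real
  assumes "0 < x"
  shows "x * (1 - (tanh x)\<^sup>2) \<le> tanh x"
proof -
  have "\<exists>t>0. t < x \<and> tanh x - tanh 0 = (x - 0) * (1 - (tanh t)\<^sup>2)"
    using assms by (intro MVT2) (auto intro!: derivative_eq_intros)
  then obtain t where t: "0 < t" "t < x" "tanh x = x * (1 - (tanh t)\<^sup>2)" by auto
  have "(tanh t)\<^sup>2 \<le> (tanh x)\<^sup>2"
    using t(1,2) by (intro power_mono) auto
  then have "x * (1 - (tanh x)\<^sup>2) \<le> x * (1 - (tanh t)\<^sup>2)"
    using assms by (intro mult_left_mono) auto
  then show ?thesis using t(3) by simp
qed

text \<open>With \<open>\<tau> = tanh (sqrt s / 2)\<close>,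
  \<open>a = (1 - \<tau>\<^sup>2) / 2\<close> and \<open>y = \<tau> / sqrt s\<close>, the derivative
  is \<open>(a - y) / (4 * s)\<close> and its bound is \<open>y / (4 * s)\<close>. The inequality
  thus reduces to \<open>0 < a \<le> y\<close>; the strict part \<open>0 < a\<close> is what later
  makes the contraction strict.\<close>

lemma weight_has_real_derivative:
  fixes s :: real
  assumes s: "0 < s"
  shows "\<exists>d. ((\<lambda>s. - 2 * A_fun (sqrt s)) has_real_derivative d) (at s) \<and>
    \<bar>d\<bar> < - 2 * A_fun (sqrt s) / (2 * s)"
proof -
  define \<tau> where "\<tau> = tanh (sqrt s / 2)"
  define d where "d = ((1 - \<tau>\<^sup>2) / 2 - \<tau> / sqrt s) / (4 * s)"
  have eq: "- 2 * A_fun (sqrt t) = tanh (sqrt t / 2) / (2 * sqrt t)" if "t > 0" for t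
    using that by (simp add: A_fun_def)
  have "((\<lambda>t. tanh (sqrt t / 2) / (2 * sqrt t)) has_real_derivative d) (at s)"
    using s by (auto intro!: derivative_eq_intros simp: d_def \<tau>_def divide_simps)
  then have "((\<lambda>s. - 2 * A_fun (sqrt s)) has_real_derivative d) (at s)"
    by (rule has_field_derivative_transform_within_open[where S = "{0<..}"]) (use s eq in auto)
  moreover have "\<bar>d\<bar> < \<tau> / sqrt s / (4 * s)"
  proof -
    have abs_less: "\<bar>a - y\<bar> < y" if "0 < a" "a \<le> y" for a y :: real
      using that by linarith
    have "\<tau>\<^sup>2 < 1"
      using tanh_real_bounds[of "sqrt s / 2"] by (simp add: \<tau>_def abs_square_less_1 abs_less_iff)
    have "sqrt s / 2 * (1 - \<tau>\<^sup>2) \<le> \<tau>"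
      using tanh_ge_mult_deriv[of "sqrt s / 2"] s by (simp add: \<tau>_def)
    then have "(1 - \<tau>\<^sup>2) / 2 \<le> \<tau> / sqrt s" using s by (simp add: field_simps)
    then have "\<bar>(1 - \<tau>\<^sup>2) / 2 - \<tau> / sqrt s\<bar> < \<tau> / sqrt s"
      using \<open>\<tau>\<^sup>2 < 1\<close> by (intro abs_less) auto
    then have "\<bar>(1 - \<tau>\<^sup>2) / 2 - \<tau> / sqrt s\<bar> / (4 * s) < \<tau> / sqrt s / (4 * s)"
      using s by (intro divide_strict_right_mono) auto
    then show ?thesis using s by (simp add: d_def abs_divide abs_mult)
  qed
  then have "\<bar>d\<bar> < - 2 * A_fun (sqrt s) / (2 * s)"
    unfolding eq[OF s] by (simp add: \<tau>_def field_simps)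
  ultimately show ?thesis by blast
qed

lemma A_fun_neg: "A_fun t < 0"
  by (cases t "0::real" rule: linorder_cases) (auto simp: A_fun_def divide_simps)

section \<open>Positive definiteness of the posterior precision\<close>

lemma pos_def_matrix_invertible:
  assumes "pos_def_matrix S"
  shows "invertible S"
proof -
  have "v = 0" if "S *v v = 0" for v
    using assms that by (metis inner_zero_right less_irrefl pos_def_matrix_def)
  then show ?thesis
    by (simp add: invertible_left_inverse matrix_left_invertible_ker)
qed

lemma pos_def_matrix_inner_commute:
  assumes "pos_def_matrix S"
  shows "u \<bullet> (S *v v) = v \<bullet> (S *v u)"
  by (metis assms dot_lmul_matrix inner_commute pos_def_matrix_def transpose_matrix_vector)

lemma pos_def_matrix_matrix_inv:
  assumes "pos_def_matrix S"
  shows "pos_def_matrix (matrix_inv S)"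
proof -
  note inv = matrix_inv_inverse[OF pos_def_matrix_invertible[OF assms]]
  have S: "S *v (matrix_inv S *v v) = v" for v
    by (simp add: matrix_vector_mul_assoc inv)
  have "transpose (matrix_inv S) = transpose (matrix_inv S) ** (S ** matrix_inv S)"
    by (simp add: inv)
  also have "\<dots> = transpose (S ** matrix_inv S) ** matrix_inv S"
    using assms by (simp add: matrix_transpose_mul matrix_mul_assoc pos_def_matrix_def)
  finally have "transpose (matrix_inv S) = matrix_inv S"
    by (simp add: inv)
  moreover have "v \<bullet> (matrix_inv S *v v) > 0" if "v \<noteq> 0" for v
  proof -
    have "matrix_inv S *v v \<noteq> 0" using S[of v] that by force
    then have "(matrix_inv S *v v) \<bullet> (S *v (matrix_inv S *v v)) > 0"
      using assms by (simp add: pos_def_matrix_def)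
    then show ?thesis by (simp add: S inner_commute)
  qed
  ultimately show ?thesis by (simp add: pos_def_matrix_def)
qed

lemma precision_post_mult:
  fixes X :: "real^'p^'n"
  shows "precision_post X \<alpha> S c *v v =
    (matrix_inv S *v v) /\<^sub>R \<alpha> + (\<Sum>k\<in>UNIV. (- 2 * A_fun (c $ k) * (row k X \<bullet> v)) *\<^sub>R row k X)"
proof -
  have "(transpose X ** diag_matrix w ** X) *v v = (\<Sum>k\<in>UNIV. (w $ k * (row k X \<bullet> v)) *\<^sub>R row k X)" for w
  proof -
    have "diag_matrix w *v (X *v v) = (\<chi> k. w $ k * (row k X \<bullet> v))"
      by (simp add: vec_eq_iff diag_matrix_def matrix_vector_mult_def row_def inner_vec_def
        if_distrib if_distribR cong: if_cong)
    then have "(transpose X ** diag_matrix w ** X) *v v = (\<chi> k. w $ k * (row k X \<bullet> v)) v* X"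
      by (simp add: matrix_vector_mul_assoc[symmetric])
    then show ?thesis
      by (simp add: vec_eq_iff vector_matrix_mult_def row_def mult_ac)
  qed
  then show ?thesis
    by (simp add: precision_post_def matrix_vector_mult_diff_rdistrib scaleR_matrix_vector_assoc[symmetric]
      scaleR_sum_right sum_negf[symmetric] mult_ac)
qed

lemma inner_precision_post:
  "u \<bullet> (precision_post X \<alpha> S c *v v) = u \<bullet> (matrix_inv S *v v) / \<alpha> +
    (\<Sum>k\<in>UNIV. - 2 * A_fun (c $ k) * (row k X \<bullet> u) * (row k X \<bullet> v))"
  by (simp add: precision_post_mult inner_add_right inner_sum_right inner_commute divide_inverse mult_ac)

text \<open>Strict positivity comes from the prior part; since \<open>A_fun\<close> is negative, the
  observations only add nonnegative terms.\<close>

lemma pos_def_precision_post: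
  assumes S: "pos_def_matrix S" and \<alpha>: "0 < \<alpha>"
  shows "pos_def_matrix (precision_post X \<alpha> S c)"
  unfolding pos_def_matrix_def
proof (intro conjI allI impI)
  note R = pos_def_matrix_matrix_inv[OF S]
  let ?P = "precision_post X \<alpha> S c"
  have "u \<bullet> (transpose ?P *v v) = u \<bullet> (?P *v v)" for u v
    using pos_def_matrix_inner_commute[OF R, of u v]
    by (simp add: inner_commute[of _ "v v* ?P"] dot_lmul_matrix inner_precision_post mult_ac)
  then show "transpose ?P = ?P"
    by (metis matrix_eq vector_eq_ldot)
  fix v :: "real^'a" assume "v \<noteq> 0"
  then have "v \<bullet> (matrix_inv S *v v) / \<alpha> > 0"
    using R \<alpha> by (simp add: pos_def_matrix_def)
  moreover have "(\<Sum>k\<in>UNIV. - 2 * A_fun (c $ k) * (row k X \<bullet> v) * (row k X \<bullet> v)) \<ge> 0"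
    using A_fun_neg[of "c $ _"]
    by (intro sum_nonneg) (simp add: mult_nonpos_nonneg mult.assoc less_imp_le)
  ultimately show "0 < v \<bullet> (?P *v v)"
    unfolding inner_precision_post by linarith
qed

section \<open>Contraction estimate for the linearised recursion\<close>

text \<open>\<open>J\<close> is the linearised recursion \<open>G diag(V)\<close> at \<open>d\<close>. The bilinear form of \<open>G\<close> is at most
  \<open>(|a|\<^sup>2 + |b|\<^sup>2) / 2\<close> in the norm with weights \<open>1 / U\<close>; applied to \<open>a = U J\<close> and \<open>b = V d\<close>, half of
  \<open>|J|\<^sup>2\<close> is absorbed on the left. No Schur product theorem is needed for the entrywise square:
  AM-GM with the ratios \<open>w k / w i\<close> and the row bounds \<open>rows\<close> suffice.\<close>

lemma gram_contraction:
  fixes H :: "real^'n^'n" and m w V d :: "real^'n" and \<alpha> r :: real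
  defines "\<psi> \<equiv> \<lambda>i. H $ i $ i / \<alpha> + (m $ i)\<^sup>2"
  defines "U \<equiv> \<lambda>i. w $ i / (2 * \<psi> i)"
  defines "G \<equiv> \<lambda>i k. (H $ i $ k)\<^sup>2 / \<alpha> + 2 * H $ i $ k * m $ i * m $ k"
  defines "J \<equiv> \<lambda>i. \<Sum>k\<in>UNIV. G i k * V $ k * d $ k"
  assumes \<alpha>: "0 < \<alpha>" and w: "\<And>i. 0 < w $ i" and diag: "\<And>i. 0 < H $ i $ i"
    and sym: "\<And>i k. H $ i $ k = H $ k $ i"
    and psd: "\<And>a. 0 \<le> (\<Sum>i\<in>UNIV. \<Sum>k\<in>UNIV. a i * a k * H $ i $ k)"
    and bound: "\<And>a. (\<Sum>i\<in>UNIV. \<Sum>k\<in>UNIV. a i * a k * H $ i $ k) \<le> (\<Sum>i\<in>UNIV. (a i)\<^sup>2 / w $ i)"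
    and rows: "\<And>i. (\<Sum>k\<in>UNIV. w $ k * (H $ i $ k)\<^sup>2) \<le> H $ i $ i"
    and V: "\<And>i. \<bar>V $ i\<bar> \<le> r * U i"
  shows "(\<Sum>i\<in>UNIV. U i * (J i)\<^sup>2) \<le> r\<^sup>2 * (\<Sum>i\<in>UNIV. U i * (d $ i)\<^sup>2)"
proof -
  have \<psi>: "0 < \<psi> i" for i
    using diag[of i] \<alpha> by (auto simp: \<psi>_def intro: add_pos_nonneg)
  have U: "0 < U i" for i
    using w[of i] \<psi>[of i] by (simp add: U_def)
  have half: "(\<Sum>i\<in>UNIV. \<Sum>k\<in>UNIV. a i * b k * (H $ i $ k)\<^sup>2) \<le>
      (\<Sum>i\<in>UNIV. ((a i)\<^sup>2 + (b i)\<^sup>2) / 2 * H $ i $ i / w $ i)" for a b :: "'n \<Rightarrow> real"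
  proof -
    have row: "(\<Sum>i\<in>UNIV. \<Sum>k\<in>UNIV. (a i)\<^sup>2 / 2 * w $ k / w $ i * (H $ i $ k)\<^sup>2) \<le>
        (\<Sum>i\<in>UNIV. (a i)\<^sup>2 / 2 * H $ i $ i / w $ i)" for a :: "'n \<Rightarrow> real"
    proof (rule sum_mono)
      fix i
      have "(\<Sum>k\<in>UNIV. (a i)\<^sup>2 / 2 * w $ k / w $ i * (H $ i $ k)\<^sup>2) =
          (a i)\<^sup>2 / 2 / w $ i * (\<Sum>k\<in>UNIV. w $ k * (H $ i $ k)\<^sup>2)"
        by (simp add: sum_distrib_left mult_ac)
      also have "\<dots> \<le> (a i)\<^sup>2 / 2 / w $ i * H $ i $ i"
        using rows w[of i] by (intro mult_left_mono) auto
      finally show "(\<Sum>k\<in>UNIV. (a i)\<^sup>2 / 2 * w $ k / w $ i * (H $ i $ k)\<^sup>2) \<le>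
          (a i)\<^sup>2 / 2 * H $ i $ i / w $ i" by simp
    qed
    have amgm: "a i * b k \<le> (a i)\<^sup>2 / 2 * w $ k / w $ i + (b k)\<^sup>2 / 2 * w $ i / w $ k" for i k
    proof -
      have "0 \<le> (a i * w $ k - b k * w $ i)\<^sup>2" by simp
      then have "2 * (a i * b k) * (w $ i * w $ k) \<le> (a i * w $ k)\<^sup>2 + (b k * w $ i)\<^sup>2"
        by (simp add: power2_diff algebra_simps)
      then show ?thesis
        using w[of i] w[of k] by (simp add: field_simps power2_eq_square)
    qed
    have "(\<Sum>i\<in>UNIV. \<Sum>k\<in>UNIV. a i * b k * (H $ i $ k)\<^sup>2) \<le>
        (\<Sum>i\<in>UNIV. \<Sum>k\<in>UNIV. (a i)\<^sup>2 / 2 * w $ k / w $ i * (H $ i $ k)\<^sup>2 +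
          (b k)\<^sup>2 / 2 * w $ i / w $ k * (H $ i $ k)\<^sup>2)"
      using mult_right_mono[OF amgm, of "(H $ _ $ _)\<^sup>2"] by (intro sum_mono) (simp add: distrib_right)
    \<comment> \<open>Exchanging the order of summation and using the symmetry of \<open>H\<close>
      brings the \<open>b\<close> part into the form of the \<open>a\<close> part, so that one row
      bound serves both.\<close>
    also have "\<dots> = (\<Sum>i\<in>UNIV. \<Sum>k\<in>UNIV. (a i)\<^sup>2 / 2 * w $ k / w $ i * (H $ i $ k)\<^sup>2) +
        (\<Sum>i\<in>UNIV. \<Sum>k\<in>UNIV. (b i)\<^sup>2 / 2 * w $ k / w $ i * (H $ i $ k)\<^sup>2)"
      by (subst (2) sum.swap) (simp add: sum.distrib sym)
    also have "\<dots> \<le> (\<Sum>i\<in>UNIV. (a i)\<^sup>2 / 2 * H $ i $ i / w $ i) + (\<Sum>i\<in>UNIV. (b i)\<^sup>2 / 2 * H $ i $ i / w $ i)"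
      by (intro add_mono row)
    finally show ?thesis
      by (simp add: sum.distrib[symmetric] add_divide_distrib distrib_right)
  qed
  have form: "(\<Sum>i\<in>UNIV. \<Sum>k\<in>UNIV. a i * b k * H $ i $ k) \<le>
      (\<Sum>i\<in>UNIV. ((a i)\<^sup>2 + (b i)\<^sup>2) / 2 / w $ i)" for a b :: "'n \<Rightarrow> real"
  proof -
    let ?q = "\<lambda>a b. \<Sum>i\<in>UNIV. \<Sum>k\<in>UNIV. a i * b k * H $ i $ k"
    have comm: "?q b a = ?q a b"
      by (subst sum.swap) (simp add: sym mult_ac)
    \<comment> \<open>Positive semidefiniteness at \<open>a - b\<close> bounds the mixed value
      \<open>?q a b\<close> by the mean of the two pure ones.\<close>
    have "0 \<le> ?q (\<lambda>i. a i - b i) (\<lambda>i. a i - b i)" by (rule psd)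
    also have "\<dots> = ?q a a + ?q b b - ?q a b - ?q b a"
      by (simp add: algebra_simps sum.distrib sum_subtractf)
    finally have "2 * ?q a b \<le> ?q a a + ?q b b" using comm by linarith
    also have "\<dots> \<le> (\<Sum>i\<in>UNIV. (a i)\<^sup>2 / w $ i) + (\<Sum>i\<in>UNIV. (b i)\<^sup>2 / w $ i)"
      by (intro add_mono bound)
    also have "\<dots> = 2 * (\<Sum>i\<in>UNIV. ((a i)\<^sup>2 + (b i)\<^sup>2) / 2 / w $ i)"
      by (simp add: sum_distrib_left sum.distrib[symmetric] add_divide_distrib)
    finally show ?thesis by simp
  qed
  have bilin: "(\<Sum>i\<in>UNIV. \<Sum>k\<in>UNIV. a i * b k * G i k) \<le>
      (\<Sum>i\<in>UNIV. ((a i)\<^sup>2 + (b i)\<^sup>2) / 2 / U i)" for a b :: "'n \<Rightarrow> real"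
  proof -
    have "(\<Sum>i\<in>UNIV. \<Sum>k\<in>UNIV. a i * b k * G i k) =
        (\<Sum>i\<in>UNIV. \<Sum>k\<in>UNIV. a i * b k * (H $ i $ k)\<^sup>2) / \<alpha> +
        2 * (\<Sum>i\<in>UNIV. \<Sum>k\<in>UNIV. (a i * m $ i) * (b k * m $ k) * H $ i $ k)"
      by (simp add: G_def sum_distrib_left sum_divide_distrib sum.distrib distrib_left mult_ac)
    also have "\<dots> \<le> (\<Sum>i\<in>UNIV. ((a i)\<^sup>2 + (b i)\<^sup>2) / 2 * H $ i $ i / w $ i) / \<alpha> +
        2 * (\<Sum>i\<in>UNIV. ((a i * m $ i)\<^sup>2 + (b i * m $ i)\<^sup>2) / 2 / w $ i)"
      using half[of a b] form[of "\<lambda>i. a i * m $ i" "\<lambda>i. b i * m $ i"] \<alpha>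
      by (intro add_mono mult_left_mono divide_right_mono) auto
    also have "\<dots> = (\<Sum>i\<in>UNIV. ((a i)\<^sup>2 + (b i)\<^sup>2) / 2 / w $ i * (H $ i $ i / \<alpha> + 2 * (m $ i)\<^sup>2))"
      by (simp add: sum_distrib_left sum_divide_distrib sum.distrib[symmetric] power_mult_distrib
        add_divide_distrib algebra_simps)
    \<comment> \<open>The cross term of \<open>G\<close> carries a factor 2, so
      \<open>(m $ i)\<^sup>2\<close> occurs twice but \<open>H $ i $ i / \<alpha>\<close> once; the
      latter is nonnegative and may be doubled to reach \<open>2 * \<psi> i\<close>.\<close>
    also have "\<dots> \<le> (\<Sum>i\<in>UNIV. ((a i)\<^sup>2 + (b i)\<^sup>2) / 2 / w $ i * (2 * \<psi> i))"
    proof (intro sum_mono mult_left_mono)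
      fix i
      have double: "a + 2 * b \<le> 2 * (a + b)" if "0 \<le> a" for a b :: real
        using that by (simp add: distrib_left)
      show "H $ i $ i / \<alpha> + 2 * (m $ i)\<^sup>2 \<le> 2 * \<psi> i"
        unfolding \<psi>_def by (rule double) (use diag[of i] \<alpha> in simp)
    qed (use w in \<open>simp add: less_imp_le\<close>)
    finally show ?thesis by (simp add: U_def mult_ac)
  qed
  let ?a = "\<lambda>i. U i * J i" and ?b = "\<lambda>k. V $ k * d $ k"
  have "(\<Sum>i\<in>UNIV. U i * (J i)\<^sup>2) = (\<Sum>i\<in>UNIV. \<Sum>k\<in>UNIV. ?a i * ?b k * G i k)"
  proof (rule sum.cong)
    fix i
    have "U i * (J i)\<^sup>2 = ?a i * (\<Sum>k\<in>UNIV. ?b k * G i k)"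
      by (simp add: power2_eq_square J_def mult_ac)
    also have "\<dots> = (\<Sum>k\<in>UNIV. ?a i * ?b k * G i k)"
      by (simp add: sum_distrib_left mult_ac)
    finally show "U i * (J i)\<^sup>2 = (\<Sum>k\<in>UNIV. ?a i * ?b k * G i k)" .
  qed simp
  also have "\<dots> \<le> (\<Sum>i\<in>UNIV. ((?a i)\<^sup>2 + (?b i)\<^sup>2) / 2 / U i)" by (rule bilin)
  also have "\<dots> = (\<Sum>i\<in>UNIV. U i * (J i)\<^sup>2) / 2 + (\<Sum>i\<in>UNIV. (?b i)\<^sup>2 / U i) / 2"
    unfolding sum_divide_distrib sum.distrib[symmetric]
    using less_imp_neq[OF U] by (intro sum.cong) (simp_all add: add_divide_distrib power2_eq_square mult_ac)
  finally have "(\<Sum>i\<in>UNIV. U i * (J i)\<^sup>2) \<le> (\<Sum>i\<in>UNIV. (?b i)\<^sup>2 / U i)" by linarith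
  also have "\<dots> \<le> (\<Sum>i\<in>UNIV. r\<^sup>2 * (U i * (d $ i)\<^sup>2))"
  proof (rule sum_mono)
    fix i
    have "(V $ i)\<^sup>2 \<le> (r * U i)\<^sup>2"
      using V[of i] by (metis abs_ge_zero power2_abs power_mono)
    then have "(?b i)\<^sup>2 / U i \<le> (r * U i)\<^sup>2 * (d $ i)\<^sup>2 / U i"
      using U[of i] by (simp add: power_mult_distrib divide_right_mono mult_right_mono)
    also have "\<dots> = r\<^sup>2 * (U i * (d $ i)\<^sup>2)"
      using U[of i] by (simp add: power2_eq_square)
    finally show "(?b i)\<^sup>2 / U i \<le> r\<^sup>2 * (U i * (d $ i)\<^sup>2)" .
  qed
  finally show ?thesis by (simp add: sum_distrib_left)
qed

section \<open>Identities and bounds for the posterior covariance\<close>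

lemma precision_post_Sigma_post:
  assumes "pos_def_matrix S" "0 < \<alpha>"
  shows "precision_post X \<alpha> S c *v (Sigma_post X \<alpha> S c *v v) = v"
  using matrix_inv_inverse(1)[OF pos_def_matrix_invertible[OF pos_def_precision_post[OF assms, of X c]]]
  by (simp add: matrix_vector_mul_assoc Sigma_post_def)

lemma pos_def_Sigma_post:
  assumes "pos_def_matrix S" "0 < \<alpha>"
  shows "pos_def_matrix (Sigma_post X \<alpha> S c)"
  unfolding Sigma_post_def by (intro pos_def_matrix_matrix_inv pos_def_precision_post assms)

text \<open>The resolvent identity \<open>Q - Q' = Q (P' - P) Q'\<close> in bilinear form: the prior
  parts of the two precisions cancel, which leaves the row terms. The identity is exact, not only
  first order, as the secant form of the derivative requires.\<close>

lemma inner_Sigma_post_diff: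
  fixes X :: "real^'p^'n"
  assumes "pos_def_matrix S" "0 < \<alpha>"
  shows "u \<bullet> (Sigma_post X \<alpha> S c *v v) - u \<bullet> (Sigma_post X \<alpha> S c' *v v) =
    (\<Sum>k\<in>UNIV. (2 * A_fun (c $ k) - 2 * A_fun (c' $ k)) *
      (row k X \<bullet> (Sigma_post X \<alpha> S c *v u)) * (row k X \<bullet> (Sigma_post X \<alpha> S c' *v v)))"
proof -
  let ?P = "precision_post X \<alpha> S" and ?Q = "Sigma_post X \<alpha> S"
  note PQ = precision_post_Sigma_post[OF assms]
  define p q where "p = ?Q c *v u" and "q = ?Q c' *v v"
  have "u \<bullet> (?Q c *v v) = v \<bullet> p"
    unfolding p_def by (intro pos_def_matrix_inner_commute pos_def_Sigma_post assms)
  also have "\<dots> = p \<bullet> (?P c' *v q)" by (simp add: q_def PQ inner_commute)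
  finally have 1: "u \<bullet> (?Q c *v v) = p \<bullet> (?P c' *v q)" .
  have "u \<bullet> (?Q c' *v v) = q \<bullet> (?P c *v p)" by (simp add: p_def q_def PQ inner_commute)
  also have "\<dots> = p \<bullet> (?P c *v q)"
    by (intro pos_def_matrix_inner_commute pos_def_precision_post assms)
  finally show ?thesis
    unfolding 1 inner_precision_post p_def[symmetric] q_def[symmetric]
    by (simp add: sum_subtractf[symmetric] left_diff_distrib)
qed

text \<open>For \<open>q = Sigma_post X \<alpha> S c *v v\<close> the right side is the quadratic
  form of the precision at \<open>q\<close>; the left side is the same form without its nonnegative
  prior part.\<close>

lemma sum_weighted_rows_Sigma_post_le:
  fixes X :: "real^'p^'n"
  assumes "pos_def_matrix S" "0 < \<alpha>"
  shows "(\<Sum>k\<in>UNIV. - 2 * A_fun (c $ k) * (row k X \<bullet> (Sigma_post X \<alpha> S c *v v))\<^sup>2) \<le>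
    v \<bullet> (Sigma_post X \<alpha> S c *v v)"
proof -
  define q where "q = Sigma_post X \<alpha> S c *v v"
  have "0 \<le> q \<bullet> (matrix_inv S *v q) / \<alpha>"
    using pos_def_matrix_matrix_inv[OF assms(1)] assms(2)
    by (cases "q = 0") (auto simp: pos_def_matrix_def less_imp_le)
  moreover have "v \<bullet> q = q \<bullet> (precision_post X \<alpha> S c *v q)"
    by (simp add: q_def precision_post_Sigma_post[OF assms] inner_commute)
  ultimately show ?thesis
    unfolding inner_precision_post q_def[symmetric] by (simp add: power2_eq_square mult.assoc)
qed

section \<open>Components and continuity of the recursion\<close>

text \<open>The symmetry of the posterior covariance turns the posterior mean into
  \<open>Sigma_post X \<alpha> S c *v b\<close>. As \<open>b\<close> does not depend on
  \<open>c\<close>, the state enters the recursion through the covariance alone.\<close>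

lemma em_rhs_component:
  fixes X :: "real^'p^'n" and Y :: "real^'n" and m :: "real^'p"
  assumes "pos_def_matrix S" "0 < \<alpha>"
  defines "b \<equiv> (Y - (\<chi> i. 1 / 2)) v* X + (m v* matrix_inv S) /\<^sub>R \<alpha>"
  shows "em_rhs X Y \<alpha> m S c $ i = row i X \<bullet> (Sigma_post X \<alpha> S c *v row i X) / \<alpha> +
    (row i X \<bullet> (Sigma_post X \<alpha> S c *v b))\<^sup>2"
proof -
  let ?Q = "Sigma_post X \<alpha> S c"
  have mu: "mu_post X Y \<alpha> m S c = ?Q *v b"
    using pos_def_Sigma_post[OF assms(1,2), of X c]
    unfolding mu_post_def b_def by (metis pos_def_matrix_def transpose_matrix_vector)
  have entry: "(X ** M ** transpose X) $ i $ i = row i X \<bullet> (M *v row i X)" for M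
    by (simp add: matrix_matrix_mult_def matrix_vector_mult_def transpose_def row_def inner_vec_def
      sum_distrib_left sum_distrib_right mult_ac) (subst sum.swap, simp add: mult_ac)
  have outer: "outer v *v u = (v \<bullet> u) *\<^sub>R v" for u v :: "real^'p"
    by (simp add: outer_def columnvector_def rowvector_def matrix_matrix_mult_def
      matrix_vector_mult_def vec_eq_iff inner_vec_def sum_distrib_left sum_distrib_right mult_ac)
  show ?thesis
    unfolding em_rhs_def diag_entries_def mu
    by (simp add: entry matrix_vector_mult_add_rdistrib scaleR_matrix_vector_assoc[symmetric] outer
      inner_add_right power2_eq_square inner_commute divide_inverse mult_ac)
qed

text \<open>The precision is affine in the numbers \<open>A_fun (g \<psi> $ k)\<close>, and positive
  definiteness makes it invertible at every \<open>\<psi>\<close>, so its inverse inherits their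
  continuity.\<close>

lemma isCont_Sigma_post:
  fixes X :: "real^'p^'n"
  assumes S: "pos_def_matrix S" "0 < \<alpha>"
    and cont: "\<And>k. isCont (\<lambda>\<psi>. A_fun (g \<psi> $ k)) z"
  shows "isCont (\<lambda>\<psi>. u \<bullet> (Sigma_post X \<alpha> S (g \<psi>) *v v)) z"
proof -
  let ?P = "\<lambda>\<psi>. precision_post X \<alpha> S (g \<psi>)"
  have "?P \<psi> $ a $ b = axis a 1 \<bullet> (?P \<psi> *v axis b 1)" for \<psi> a b
    by (simp add: inner_axis' matrix_vector_mult_basis column_def)
  then have "isCont (\<lambda>\<psi>. ?P \<psi> $ a $ b) z" for a b
    unfolding inner_precision_post using cont S by (simp only:) (intro continuous_intros, auto)
  then have "isCont ?P z"
    unfolding isCont_def by (intro vec_tendstoI)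
  then have "isCont (\<lambda>\<psi>. Sigma_post X \<alpha> S (g \<psi>)) z"
    unfolding Sigma_post_def
    by (intro isCont_matrix_inv pos_def_matrix_invertible pos_def_precision_post S)
  then show ?thesis
    unfolding inner_vec_def matrix_vector_mult_def by (simp add: continuous_intros)
qed

section \<open>Stability of a fixed point\<close>

lemma em_map_fixed_point_stable:
  fixes X :: "real^'p^'n" and Y c :: "real^'n" and m :: "real^'p" and S :: "real^'p^'p"
  assumes X: "\<And>i. row i X \<noteq> 0" and S: "pos_def_matrix S" "0 < \<alpha>"
    and c: "\<And>i. 0 \<le> c $ i" and fixpoint: "(\<chi> i. (c $ i)\<^sup>2) = em_rhs X Y \<alpha> m S c"
  shows "locally_asymptotically_stable_on nonneg_orthant (em_map X Y \<alpha> m S) (\<chi> i. (c $ i)\<^sup>2)"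
proof -
  define z where "z = (\<chi> i. (c $ i)\<^sup>2)"
  define g :: "real^'n \<Rightarrow> real^'n" where "g = (\<lambda>\<psi>. \<chi> i. sqrt (\<psi> $ i))"
  define b where "b = (Y - (\<chi> i. 1 / 2)) v* X + (m v* matrix_inv S) /\<^sub>R \<alpha>"
  define Q where "Q = (\<lambda>\<psi>. Sigma_post X \<alpha> S (g \<psi>))"
  let ?x = "\<lambda>i. row i X" and ?f = "em_map X Y \<alpha> m S"
  have gz: "g z = c" by (simp add: g_def z_def vec_eq_iff c)
  have f: "?f \<psi> $ i = ?x i \<bullet> (Q \<psi> *v ?x i) / \<alpha> + (?x i \<bullet> (Q \<psi> *v b))\<^sup>2" for \<psi> i
    by (simp add: em_map_def em_rhs_component[OF S] Q_def g_def b_def)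
  have fz: "?f z = z" using fixpoint gz by (simp add: em_map_def z_def g_def)
  have Q: "pos_def_matrix (Q \<psi>)" for \<psi>
    unfolding Q_def by (rule pos_def_Sigma_post[OF S])
  note Q_comm = pos_def_matrix_inner_commute[OF Q]

  define H where "H = (\<chi> i k. ?x i \<bullet> (Q z *v ?x k))"
  have H_eq: "?x k \<bullet> (Q z *v ?x i) = H $ i $ k" for i k
    using Q_comm[of "?x k" z "?x i"] by (simp add: H_def)
  define M where "M = (\<chi> i. ?x i \<bullet> (Q z *v b))"
  define w where "w = (\<chi> k. - 2 * A_fun (c $ k))"
  have Hdiag: "0 < H $ i $ i" for i
    using Q X by (simp add: H_def pos_def_matrix_def)
  have z_eq: "z $ i = H $ i $ i / \<alpha> + (M $ i)\<^sup>2" for i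
    using f[of z i] by (simp add: fz H_def M_def)
  \<comment> \<open>Nonzero rows and a positive definite covariance keep the fixed point in the
    interior of the orthant, where \<open>sqrt\<close> is differentiable and only its values at
    positive arguments affect the derivative.\<close>
  have z_pos: "0 < z $ i" for i
    unfolding z_eq using Hdiag[of i] S(2) by (intro add_pos_nonneg) auto
  have w_pos: "0 < w $ i" for i using A_fun_neg[of "c $ i"] by (simp add: w_def)

  \<comment> \<open>Here \<open>h\<close> is the secant slope of the weight at \<open>z $ k\<close>,
    continuous there with value the derivative. It makes the weight differences in the resolvent
    identity exact multiples of \<open>\<psi> $ k - z $ k\<close>.\<close>
  have "\<forall>k. \<exists>h d. (\<forall>s. - 2 * A_fun (sqrt s) - - 2 * A_fun (sqrt (z $ k)) = h s * (s - z $ k)) \<and>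
      isCont h (z $ k) \<and> h (z $ k) = d \<and> \<bar>d\<bar> < w $ k / (2 * z $ k)"
  proof
    fix k
    obtain d where d: "((\<lambda>s. - 2 * A_fun (sqrt s)) has_real_derivative d) (at (z $ k))"
      "\<bar>d\<bar> < - 2 * A_fun (sqrt (z $ k)) / (2 * z $ k)"
      using weight_has_real_derivative[OF z_pos] by blast
    moreover have "- 2 * A_fun (sqrt (z $ k)) = w $ k" using c by (simp add: w_def z_def)
    ultimately show "\<exists>h d. (\<forall>s. - 2 * A_fun (sqrt s) - - 2 * A_fun (sqrt (z $ k)) = h s * (s - z $ k)) \<and>
        isCont h (z $ k) \<and> h (z $ k) = d \<and> \<bar>d\<bar> < w $ k / (2 * z $ k)"
      unfolding CARAT_DERIV by metis
  qed
  then obtain h where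
    h: "\<And>k s. - 2 * A_fun (sqrt s) - - 2 * A_fun (sqrt (z $ k)) = h k s * (s - z $ k)"
    and h_cont: "\<And>k. isCont (h k) (z $ k)"
    and h_less: "\<And>k. \<bar>h k (z $ k)\<bar> < w $ k / (2 * z $ k)"
    by metis

  \<comment> \<open>This secant matrix comes from the resolvent identity in the variance term and,
    after factoring a difference of squares, in the squared mean. At \<open>z\<close> the sum of the
    two means becomes \<open>2 * M $ i\<close>, and \<open>J z\<close> is the derivative described
    at the outset.\<close>
  define J where "J = (\<lambda>\<psi>. \<chi> i k. - h k (\<psi> $ k) *
    ((?x k \<bullet> (Q \<psi> *v ?x i)) * (?x k \<bullet> (Q z *v ?x i)) / \<alpha> +
     (?x k \<bullet> (Q \<psi> *v ?x i)) * (?x k \<bullet> (Q z *v b)) * (?x i \<bullet> (Q \<psi> *v b) + ?x i \<bullet> (Q z *v b))))"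
  have Q_diff: "u \<bullet> (Q \<psi> *v v) - u \<bullet> (Q z *v v) =
      (\<Sum>k\<in>UNIV. - h k (\<psi> $ k) * (\<psi> $ k - z $ k) * (?x k \<bullet> (Q \<psi> *v u)) * (?x k \<bullet> (Q z *v v)))" for \<psi> u v
  proof -
    have "2 * A_fun (g \<psi> $ k) - 2 * A_fun (g z $ k) = - h k (\<psi> $ k) * (\<psi> $ k - z $ k)" for k
      using h[of "\<psi> $ k" k] by (simp add: g_def)
    then show ?thesis
      unfolding Q_def inner_Sigma_post_diff[OF S] by simp
  qed
  have mult_component: "(A *v v) $ i = (\<Sum>k\<in>UNIV. A $ i $ k * v $ k)" for A :: "real^'n^'n" and v i
    by (simp add: matrix_vector_mult_def)
  have secant: "?f \<psi> - ?f z = J \<psi> *v (\<psi> - z)" for \<psi>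
  proof -
    have "?f \<psi> $ i - ?f z $ i = (J \<psi> *v (\<psi> - z)) $ i" for i
    proof -
      have "?f \<psi> $ i - ?f z $ i = (?x i \<bullet> (Q \<psi> *v ?x i) - ?x i \<bullet> (Q z *v ?x i)) / \<alpha> +
          (?x i \<bullet> (Q \<psi> *v b) - ?x i \<bullet> (Q z *v b)) * (?x i \<bullet> (Q \<psi> *v b) + ?x i \<bullet> (Q z *v b))"
        by (simp add: f power2_eq_square algebra_simps diff_divide_distrib)
      also have "\<dots> = (J \<psi> *v (\<psi> - z)) $ i"
        unfolding Q_diff mult_component sum_divide_distrib sum_distrib_right sum.distrib[symmetric]
        by (intro sum.cong) (simp_all add: J_def algebra_simps add_divide_distrib diff_divide_distrib)
      finally show ?thesis .
    qed
    then show ?thesis by (simp add: vec_eq_iff)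
  qed
  have h_cont: "isCont (\<lambda>\<psi>. h k (\<psi> $ k)) z" for k
    by (rule isCont_o2[where f = "\<lambda>\<psi>. \<psi> $ k"]) (auto intro: h_cont)
  \<comment> \<open>Solving the secant identity for \<open>A_fun\<close> expresses it through
    functions already known to be continuous at \<open>z\<close>.\<close>
  have "isCont (\<lambda>\<psi>. A_fun (g \<psi> $ k)) z" for k
  proof -
    have "isCont (\<lambda>\<psi>. A_fun (sqrt (z $ k)) - h k (\<psi> $ k) * (\<psi> $ k - z $ k) / 2) z"
      by (intro continuous_intros h_cont) auto
    moreover have "A_fun (g \<psi> $ k) = A_fun (sqrt (z $ k)) - h k (\<psi> $ k) * (\<psi> $ k - z $ k) / 2" for \<psi>
      using h[of "\<psi> $ k" k] by (simp add: g_def)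
    ultimately show ?thesis by simp
  qed
  then have Q_cont: "isCont (\<lambda>\<psi>. u \<bullet> (Q \<psi> *v v)) z" for u v
    unfolding Q_def by (rule isCont_Sigma_post[OF S])
  have "isCont (\<lambda>\<psi>. J \<psi> $ i $ k) z" for i k
    unfolding J_def using S(2)
    by simp (intro continuous_intros Q_cont h_cont, auto)
  then have "isCont J z"
    unfolding isCont_def by (intro vec_tendstoI)
  with secant have deriv: "(?f has_derivative (*v) (J z)) (at z)"
    by (rule has_derivative_at_if_continuous_secant)

  define U where "U = (\<lambda>i. w $ i / (2 * z $ i))"
  have U: "0 < U i" for i using w_pos z_pos by (simp add: U_def)
  have h_less: "\<bar>h i (z $ i)\<bar> < U i" for i using h_less by (simp add: U_def)
  \<comment> \<open>The maximum over finitely many coordinates is attained, so the strict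
    coordinatewise bounds give one rate \<open>r < 1\<close>.\<close>
  define r where "r = Max (range (\<lambda>i. \<bar>h i (z $ i)\<bar> / U i))"
  have r_ge: "\<bar>h i (z $ i)\<bar> / U i \<le> r" for i unfolding r_def by (intro Max_ge) auto
  have "r \<in> range (\<lambda>i. \<bar>h i (z $ i)\<bar> / U i)" unfolding r_def by (intro Max_in) auto
  then have r: "0 \<le> r" "r < 1" using h_less U by (auto simp: less_imp_le)

  \<comment> \<open>Scaling by \<open>sqrt (U i)\<close> realises the weighted Euclidean norm as
    \<open>norm (T u)\<close>.\<close>
  define T where "T = (\<lambda>u::real^'n. (\<chi> i. sqrt (U i) * u $ i) :: real^'n)"
  have T_lin: "linear T"
    by (rule linearI) (simp_all add: T_def vec_eq_iff algebra_simps)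
  have T_inj: "inj T"
    using U by (intro injI) (simp add: T_def vec_eq_iff less_imp_neq[symmetric])
  have T_norm: "(norm (T u))\<^sup>2 = (\<Sum>i\<in>UNIV. U i * (u $ i)\<^sup>2)" for u
    using U by (simp add: T_def norm_vec_def L2_set_def sum_nonneg power_mult_distrib less_imp_le)

  have H_form: "(\<Sum>i\<in>UNIV. \<Sum>k\<in>UNIV. a i * a k * H $ i $ k) =
      (\<Sum>i\<in>UNIV. a i *\<^sub>R ?x i) \<bullet> (Q z *v (\<Sum>k\<in>UNIV. a k *\<^sub>R ?x k))" for a :: "'n \<Rightarrow> real"
  proof -
    have lin: "Q z *v (\<Sum>k\<in>UNIV. a k *\<^sub>R ?x k) = (\<Sum>k\<in>UNIV. a k *\<^sub>R (Q z *v ?x k))"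
      by (simp add: linear_sum[OF matrix_vector_mul_linear] linear_scale[OF matrix_vector_mul_linear])
    show ?thesis
      unfolding lin inner_sum_left by (simp add: H_def inner_sum_right mult_ac)
  qed
  have Q_nonneg: "0 \<le> v \<bullet> (Q z *v v)" for v
    using Q[of z] by (cases "v = 0") (auto simp: pos_def_matrix_def less_imp_le)
  have rows: "(\<Sum>k\<in>UNIV. w $ k * (?x k \<bullet> (Q z *v v))\<^sup>2) \<le> v \<bullet> (Q z *v v)" for v
    using sum_weighted_rows_Sigma_post_le[OF S, of c X v] by (simp add: w_def Q_def gz)
  have contr: "norm (T (J z *v u)) \<le> r * norm (T u)" for u
  proof (rule power2_le_imp_le)
    have "(\<Sum>i\<in>UNIV. w $ i / (2 * (H $ i $ i / \<alpha> + (M $ i)\<^sup>2)) *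
          (\<Sum>k\<in>UNIV. ((H $ i $ k)\<^sup>2 / \<alpha> + 2 * H $ i $ k * M $ i * M $ k) *
            (\<chi> k. - h k (z $ k)) $ k * u $ k)\<^sup>2) \<le>
        r\<^sup>2 * (\<Sum>i\<in>UNIV. w $ i / (2 * (H $ i $ i / \<alpha> + (M $ i)\<^sup>2)) * (u $ i)\<^sup>2)"
    proof (rule gram_contraction[OF S(2) w_pos Hdiag])
      show "H $ i $ k = H $ k $ i" for i k by (metis H_eq Q_comm)
      show "0 \<le> (\<Sum>i\<in>UNIV. \<Sum>k\<in>UNIV. a i * a k * H $ i $ k)" for a :: "'n \<Rightarrow> real"
        unfolding H_form by (rule Q_nonneg)
      show "(\<Sum>i\<in>UNIV. \<Sum>k\<in>UNIV. a i * a k * H $ i $ k) \<le> (\<Sum>i\<in>UNIV. (a i)\<^sup>2 / w $ i)"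
        for a :: "'n \<Rightarrow> real"
      proof -
        define v where "v = (\<Sum>i\<in>UNIV. a i *\<^sub>R ?x i)"
        let ?e = "\<lambda>i. ?x i \<bullet> (Q z *v v)"
        \<comment> \<open>Young's inequality with weight \<open>w $ i\<close>. Summed over
          \<open>i\<close>, the left side is twice the form of \<open>Q z\<close> at
          \<open>v\<close>, while \<open>rows\<close> bounds the sum of
          \<open>w $ i * (?e i)\<^sup>2\<close> by that form once; cancelling it leaves the
          claim.\<close>
        have "2 * (a i * ?e i) \<le> (a i)\<^sup>2 / w $ i + w $ i * (?e i)\<^sup>2" for i
        proof -
          have "0 \<le> (a i - w $ i * ?e i)\<^sup>2 / w $ i" using w_pos[of i] by simp
          also have "\<dots> = (a i)\<^sup>2 / w $ i + w $ i * (?e i)\<^sup>2 - 2 * (a i * ?e i)"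
            using w_pos[of i] by (simp add: field_simps power2_eq_square)
          finally show ?thesis by linarith
        qed
        then have "(\<Sum>i\<in>UNIV. 2 * (a i * ?e i)) \<le>
            (\<Sum>i\<in>UNIV. (a i)\<^sup>2 / w $ i + w $ i * (?e i)\<^sup>2)" by (rule sum_mono)
        moreover have "v \<bullet> (Q z *v v) = (\<Sum>i\<in>UNIV. a i * ?e i)"
          by (subst v_def) (simp add: inner_sum_left)
        ultimately show ?thesis
          using rows[of v] unfolding H_form v_def[symmetric]
          by (simp add: sum.distrib sum_distrib_left[symmetric])
      qed
      show "(\<Sum>k\<in>UNIV. w $ k * (H $ i $ k)\<^sup>2) \<le> H $ i $ i" for i
        using rows[of "?x i"] by (simp add: H_eq)
      show "\<bar>(\<chi> k. - h k (z $ k)) $ i\<bar> \<le> r * (w $ i / (2 * (H $ i $ i / \<alpha> + (M $ i)\<^sup>2)))" for i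
      proof -
        have "\<bar>h i (z $ i)\<bar> \<le> r * U i" using r_ge[of i] U[of i] by (simp add: divide_le_eq)
        then show ?thesis by (simp add: U_def z_eq)
      qed
    qed
    moreover have "(J z *v u) $ i = (\<Sum>k\<in>UNIV. ((H $ i $ k)\<^sup>2 / \<alpha> + 2 * H $ i $ k * M $ i * M $ k) *
            (\<chi> k. - h k (z $ k)) $ k * u $ k)" for i
      unfolding mult_component
      by (simp add: J_def H_eq M_def power2_eq_square algebra_simps)
    ultimately show "(norm (T (J z *v u)))\<^sup>2 \<le> (r * norm (T u))\<^sup>2"
      by (simp add: T_norm power_mult_distrib U_def z_eq)
  qed (use r in simp)
  have "z \<in> nonneg_orthant" using z_pos by (simp add: nonneg_orthant_def less_imp_le)
  from locally_asymptotically_stable_on_if_contracting_derivative[OF this fz deriv T_lin T_inj r contr]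
  show ?thesis by (simp add: z_def)
qed

theorem theorem5p1:
  fixes K :: nat
    and X :: "real^'p^'n"
    and y :: "'n \<Rightarrow> nat"
    and \<mu> :: "nat \<Rightarrow> real^'p"
    and \<Sigma> :: "nat \<Rightarrow> real^'p^'p"
    and \<alpha> :: real
  assumes "K \<ge> 2"
    and "\<forall>i. row i X \<noteq> 0"
    and "\<forall>i. y i \<in> {1..K}"
    and "0 < \<alpha>" and "\<alpha> \<le> 1"
    and "\<forall>j\<in>{1..K-1}. pos_def_matrix (\<Sigma> j)"
  shows "\<forall>j\<in>{1..K-1}. \<forall>c :: real^'n.
           (\<forall>i. 0 \<le> c $ i) \<and>
           (\<chi> i. (c $ i)\<^sup>2) = em_rhs X (category_indicator y j) \<alpha> (\<mu> j) (\<Sigma> j) c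
           \<longrightarrow> locally_asymptotically_stable_on nonneg_orthant
                 (em_map X (category_indicator y j) \<alpha> (\<mu> j) (\<Sigma> j))
                 (\<chi> i. (c $ i)\<^sup>2)"
proof (intro ballI allI impI)
  fix j and c :: "real^'n"
  assume j: "j \<in> {1..K-1}" and c: "(\<forall>i. 0 \<le> c $ i) \<and>
    (\<chi> i. (c $ i)\<^sup>2) = em_rhs X (category_indicator y j) \<alpha> (\<mu> j) (\<Sigma> j) c"
  have "pos_def_matrix (\<Sigma> j)" using assms(6) j by blast
  then show "locally_asymptotically_stable_on nonneg_orthant
      (em_map X (category_indicator y j) \<alpha> (\<mu> j) (\<Sigma> j)) (\<chi> i. (c $ i)\<^sup>2)"
    using assms(2,4) c by (intro em_map_fixed_point_stable) auto
qed

end
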